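(* Let $n\ge1$, let $S^0=S^0_{111}$ be the TASEP and $X^0=X^0_{111}$ the complete chain defined below, and suppose the initial distributions satisfy that $S^0(0)$ and $\mathrm{top}(X^0(0))$ have the same law. Then for every TASEP configuration $\tau$ of length $n$ and every $t\ge0$, $\mathrm{Prob}(S^0(t)=\tau)=\mathrm{Prob}(\mathrm{top}(X^0(t))=\tau)$, and $$\mathrm{Prob}(S^0(t)=\tau)\xrightarrow[t\to\infty]{}\frac{|\{\omega\in\Omega^0_n:\mathrm{top}(\omega)=\tau\}|}{|\Omega^0_n|}.$$ In particular, for all $k,m\ge0$ with $k+m=n$, $$\mathrm{Prob}(S^0(t)\text{ contains }k\text{ black and }m\text{ white particles})\xrightarrow[t\to\infty]{}\frac{|\Omega^0_{k,m}|}{|\Omega^0_n|}=\frac{\frac{1}{n+1}\binom{n+1}{k}\binom{n+1}{m}}{C_{n+1}},$$ where $C_{n+1}=\frac{1}{n+2}\binom{2n+2}{n+1}$.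
   Context: A TASEP configuration of length $n$ is a row of $n$ cells each containing a black ($\bullet$) or white ($\circ$) particle; cells are numbered $1,\dots,n$ and walls $0,\dots,n$, wall $i$ between cells $i$ and $i+1$ (wall $0$ = left border, wall $n$ = right border). For $\alpha,\beta,\gamma\in\,]0,1]$ the TASEP $S^0_{\alpha\beta\gamma}$ is the Markov chain: at each step choose a wall $i$ uniformly in $\{0,\dots,n\}$; with probability $\lambda(i)$ (where $\lambda(i)=\alpha$ for $1\le i\le n-1$, $\lambda(0)=\beta$, $\lambda(n)=\gamma$) apply: if $1\le i\le n-1$ and cells $i,i+1$ contain $\bullet,\circ$, swap them; if $i=0$ and cell $1$ contains $\circ$, replace it by $\bullet$; if $i=n$ and cell $n$ contains $\bullet$, replace it by $\circ$; otherwise nothing changes. With the complementary probability nothing changes. A complete configuration of length $n$ is a pair of rows (top, bottom) of $n$ cells, each with a black or white particle, such that the two rows together contain $n$ black and $n$ white particles and for every $j$ the first $j$ columns contain at least as many black as white particles; $\Omega^0_n$ is their set, $\mathrm{top}(\omega)$ is the top row of $\omega$, and $\Omega^0_{k,m}$ is the set of $\omega\in\Omega^0_n$ with $k$ black and $m$ white particles in the top row. Columns are numbered $1,\dots,n$, wall $i$ between columns $i$ and $i+1$; $t_c,b_c$ are the top and bottom particles of column $c$. The map $T:\Omega^0_n\times\{0,\dots,n\}\to\Omega^0_n$ is defined by cases (unmentioned particles keep their relative order in their row): (a') $1\le i\le n-1$, $t_i=\bullet$, $t_{i+1}=\circ$, $b_{i+1}=\bullet$: with $j_1$ the smallest $j\in\{0,\dots,i-1\}$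 such that $t_{j+1},\dots,t_{i-1}$ are white, remove column $i+1$ and reinsert it as column $j_1+1$. (a'') $1\le i\le n-1$, $t_i=\bullet$, $t_{i+1}=\circ$, $b_{i+1}=\circ$: with $j_2$ the largest $j\in\{i+1,\dots,n\}$ such that $t_{i+2},\dots,t_j$ are black, delete $t_i$ and insert a black particle as top cell $j_2$; delete $b_{i+1}$ and insert a white particle as bottom cell $j_2+1$ if $j_2<n$, bottom cell $n$ if $j_2=n$. (b) $i=0$, $t_1=\circ$: with $j_2$ the largest $j\in\{1,\dots,n\}$ such that $t_2,\dots,t_j$ are black, delete column $1$, insert a black particle as top cell $j_2$ and a white particle as bottom cell $j_2+1$ if $j_2<n$, bottom cell $n$ if $j_2=n$. (c) $i=n$, $t_n=\bullet$: with $j_1$ the smallest $j\in\{0,\dots,n-1\}$ such that $t_{j+1},\dots,t_{n-1}$ are white, delete column $n$ and insert a column ($\circ$ on top, $\bullet$ below) as column $j_1+1$. (d) otherwise $T(\omega,i)=\omega$. The chain $X^0_{\alpha\beta\gamma}$ on $\Omega^0_n$: at each step choose $i$ uniformly in $\{0,\dots,n\}$; the next state is $T(X^0_{\alpha\beta\gamma}(t),i)$ with probability $\lambda(i)$ and the current state otherwise. $S^0=S^0_{111}$, $X^0=X^0_{111}$. *)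

theory Defs
  imports "HOL-Probability.Probability"
begin

datatype particle = Black | White

type_synonym config = "particle list"

definition configs :: "nat \<Rightarrow> config set" where
  "configs n = {\<tau>. length \<tau> = n}"

text \<open>Cells are numbered from 1.\<close>

definition cell :: "'a list \<Rightarrow> nat \<Rightarrow> 'a" where
  "cell xs c = xs ! (c - 1)"

definition delete_cell :: "nat \<Rightarrow> 'a list \<Rightarrow> 'a list" where
  "delete_cell c xs = take (c - 1) xs @ drop c xs"

text \<open>The inserted particle has number \<open>c\<close> in the \<^emph>\<open>resulting\<close> row.\<close>

definition insert_cell :: "nat \<Rightarrow> 'a \<Rightarrow> 'a list \<Rightarrow> 'a list" where
  "insert_cell c x xs = take (c - 1) xs @ x # drop (c - 1) xs"

definition tasep_move :: "config \<Rightarrow> nat \<Rightarrow> config" where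
  "tasep_move \<tau> i =
    (let n = length \<tau> in
     if 1 \<le> i \<and> i \<le> n - 1 \<and> cell \<tau> i = Black \<and> cell \<tau> (i + 1) = White
       then \<tau>[i - 1 := White, i := Black]
     else if i = 0 \<and> cell \<tau> 1 = White then \<tau>[0 := Black]
     else if i = n \<and> cell \<tau> n = Black then \<tau>[n - 1 := White]
     else \<tau>)"

text \<open>A complete configuration is the pair (top row, bottom row).\<close>

type_synonym complete_config = "config \<times> config"

abbreviation top_row :: "complete_config \<Rightarrow> config" where
  "top_row \<equiv> fst"

definition complete_configs :: "nat \<Rightarrow> complete_config set" where
  "complete_configs n =
    {(t, b). length t = n \<and> length b = n \<and>
       count_list (t @ b) Black = n \<and> count_list (t @ b) White = n \<and>
       (\<forall>j\<le>n. count_list (take j t @ take j b) White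
               \<le> count_list (take j t @ take j b) Black)}"

definition complete_configs_with :: "nat \<Rightarrow> nat \<Rightarrow> complete_config set" where
  "complete_configs_with k m =
    {\<omega> \<in> complete_configs (k + m).
       count_list (top_row \<omega>) Black = k \<and> count_list (top_row \<omega>) White = m}"

definition j1 :: "config \<Rightarrow> nat \<Rightarrow> nat" where
  "j1 t i = Min {j \<in> {0..i - 1}. \<forall>c \<in> {j + 1..i - 1}. cell t c = White}"

definition j2 :: "config \<Rightarrow> nat \<Rightarrow> nat" where
  "j2 t i = Max {j \<in> {i + 1..length t}. \<forall>c \<in> {i + 2..j}. cell t c = Black}"

text \<open>
  The branches are, in this order, the cases (a'), (a''), (b), (c) and (d);
  the defining conditions of \<open>j1\<close> and \<open>j2\<close> in (b) and (c) are those of (a'') and (a')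
  taken at \<open>i = 0\<close> and \<open>i = n\<close>.
\<close>

definition T :: "complete_config \<Rightarrow> nat \<Rightarrow> complete_config" where
  "T \<omega> i =
    (let t = fst \<omega>; b = snd \<omega>; n = length t;
         p = j1 t i + 1;
         q = j2 t i;
         r = (if q < n then q + 1 else n)
     in
     if 1 \<le> i \<and> i \<le> n - 1 \<and> cell t i = Black \<and> cell t (i + 1) = White
          \<and> cell b (i + 1) = Black
       then (insert_cell p (cell t (i + 1)) (delete_cell (i + 1) t),
             insert_cell p (cell b (i + 1)) (delete_cell (i + 1) b))
     else if 1 \<le> i \<and> i \<le> n - 1 \<and> cell t i = Black \<and> cell t (i + 1) = White
          \<and> cell b (i + 1) = White
       then (insert_cell q Black (delete_cell i t),
             insert_cell r White (delete_cell (i + 1) b))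
     else if i = 0 \<and> cell t 1 = White
       then (insert_cell q Black (delete_cell 1 t),
             insert_cell r White (delete_cell 1 b))
     else if i = n \<and> cell t n = Black
       then (insert_cell p White (delete_cell n t),
             insert_cell p Black (delete_cell n b))
     else \<omega>)"

definition wall_rate :: "real \<Rightarrow> real \<Rightarrow> real \<Rightarrow> nat \<Rightarrow> nat \<Rightarrow> real" where
  "wall_rate \<alpha> \<beta> \<gamma> n i = (if i = 0 then \<beta> else if i = n then \<gamma> else \<alpha>)"

definition wall_kernel ::
    "('s \<Rightarrow> nat \<Rightarrow> 's) \<Rightarrow> real \<Rightarrow> real \<Rightarrow> real \<Rightarrow> nat \<Rightarrow> 's \<Rightarrow> 's pmf" where
  "wall_kernel move \<alpha> \<beta> \<gamma> n x =
    bind_pmf (pmf_of_set {0..n}) (\<lambda>i.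
    bind_pmf (bernoulli_pmf (wall_rate \<alpha> \<beta> \<gamma> n i)) (\<lambda>success.
    return_pmf (if success then move x i else x)))"

text \<open>
  A discrete-time homogeneous Markov chain on a probability space \<open>M\<close>, with countable state
  space \<open>A\<close> and transition probabilities \<open>K\<close>; its initial distribution is arbitrary.
\<close>

definition markov_chain ::
    "'w measure \<Rightarrow> 's set \<Rightarrow> ('s \<Rightarrow> 's pmf) \<Rightarrow> (nat \<Rightarrow> 'w \<Rightarrow> 's) \<Rightarrow> bool" where
  "markov_chain M A K Z \<longleftrightarrow>
    prob_space M \<and>
    (\<forall>t. Z t \<in> measurable M (count_space A)) \<and>
    (\<forall>t x y. \<P>(w in M. \<forall>s\<le>t. Z s w = x s) \<noteq> 0 \<longrightarrow>
       \<P>(w in M. Z (Suc t) w = y \<bar> \<forall>s\<le>t. Z s w = x s) = pmf (K (x t)) y)"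

definition is_TASEP ::
    "real \<Rightarrow> real \<Rightarrow> real \<Rightarrow> nat \<Rightarrow> 'w measure \<Rightarrow> (nat \<Rightarrow> 'w \<Rightarrow> config) \<Rightarrow> bool" where
  "is_TASEP \<alpha> \<beta> \<gamma> n M S \<longleftrightarrow>
    markov_chain M (configs n) (wall_kernel tasep_move \<alpha> \<beta> \<gamma> n) S"

definition is_complete_chain ::
    "real \<Rightarrow> real \<Rightarrow> real \<Rightarrow> nat \<Rightarrow> 'w measure \<Rightarrow> (nat \<Rightarrow> 'w \<Rightarrow> complete_config) \<Rightarrow> bool" where
  "is_complete_chain \<alpha> \<beta> \<gamma> n M X \<longleftrightarrow>
    markov_chain M (complete_configs n) (wall_kernel T \<alpha> \<beta> \<gamma> n) X"

end

theory Submission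
  imports Defs
begin

text \<open>
  The top row of \<open>T \<omega> i\<close> is the TASEP move of the top row of \<open>\<omega>\<close>, so the TASEP is a projection of
  the complete chain. Together with the wall at which the moved particle stops, \<open>T\<close> becomes a
  bijection of \<open>complete_configs n \<times> {0..n}\<close>; hence the uniform distribution on complete
  configurations is stationary. Convergence holds because a fixed word of walls drives every
  TASEP configuration to the all-black one, which makes the averaging operator contract
  oscillations. A complete configuration is a pair of weakly ordered lattice paths (black prefix
  counts above, white prefix counts below), which gives the Narayana numbers.
\<close>

section \<open>Complete configurations as nonnegative paths\<close>

text \<open>For a single wall \<open>T\<close> is not injective: every image under wall 0 has a
  black first top cell. So stationarity cannot be checked wall by wall; the balance holds only after
  summing over all walls, and the exit wall does the bookkeeping. The bottom row enters only in
  identifying the limit. Convergence itself is proved for the TASEP: averaging flattens a test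
  function \<open>f\<close> to a constant, and since averaging conserves sums over complete
  configurations, this constant is the mean of \<open>f\<close> over their top rows. A word that
  merges all starting points takes the place of irreducibility and aperiodicity. The two chains live
  on unrelated probability spaces and are given by conditional probabilities, so there is no joint
  trajectory to compare. Time steps are therefore moved from the law to the test function, until
  only the initial laws remain.\<close>

fun wt :: "particle \<Rightarrow> int" where
  "wt Black = 1"
| "wt White = -1"

fun height :: "(particle \<times> particle) list \<Rightarrow> int" where
  "height [] = 0"
| "height ((x, y) # cs) = wt x + wt y + height cs"

text \<open>The starting height is a parameter so that the condition splits over concatenation. It
  is not tested itself; only the heights after each column are.\<close>

fun nonneg :: "int \<Rightarrow> (particle \<times> particle) list \<Rightarrow> bool" where
  "nonneg h [] = True"
| "nonneg h ((x, y) # cs) = (0 \<le> h + wt x + wt y \<and> nonneg (h + wt x + wt y) cs)"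

lemma height_append [simp]: "height (xs @ ys) = height xs + height ys"
  by (induction xs rule: height.induct) auto

lemma nonneg_append [simp]:
  "nonneg h (xs @ ys) \<longleftrightarrow> nonneg h xs \<and> nonneg (h + height xs) ys"
  by (induction h xs rule: nonneg.induct) (auto simp: algebra_simps)

lemma nonneg_iff:
  "0 \<le> h \<Longrightarrow> nonneg h cs \<longleftrightarrow> (\<forall>j\<le>length cs. 0 \<le> h + height (take j cs))"
proof (induction h cs rule: nonneg.induct)
  case (2 h x y cs)
  show ?case
  proof
    assume L: "nonneg h ((x, y) # cs)"
    then have "\<forall>j\<le>length cs. 0 \<le> h + wt x + wt y + height (take j cs)"
      using 2 by auto
    then show "\<forall>j\<le>length ((x, y) # cs). 0 \<le> h + height (take j ((x, y) # cs))"
      using \<open>0 \<le> h\<close> by (auto simp: take_Cons' algebra_simps)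
  next
    assume R: "\<forall>j\<le>length ((x, y) # cs). 0 \<le> h + height (take j ((x, y) # cs))"
    have "0 \<le> h + wt x + wt y + height (take j cs)" if "j \<le> length cs" for j
      using R[rule_format, of "Suc j"] that by (simp add: algebra_simps)
    moreover from this[of 0] have "0 \<le> h + wt x + wt y" by simp
    ultimately show "nonneg h ((x, y) # cs)"
      using 2 by auto
  qed
qed simp

lemma nonneg_height: "0 \<le> h \<Longrightarrow> nonneg h cs \<Longrightarrow> 0 \<le> h + height cs"
  by (metis nonneg_iff order_refl take_all_iff)

lemma height_zip:
  "length t = length b \<Longrightarrow>
   height (zip t b) = int (count_list (t @ b) Black) - int (count_list (t @ b) White)"
proof (induction t b rule: list_induct2)
  case (Cons x xs y ys)
  then show ?case by (cases x; cases y) auto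
qed simp

lemma count_Black_White: "count_list xs Black + count_list xs White = length xs"
proof (induction xs)
  case (Cons x xs)
  then show ?case by (cases x) auto
qed simp

text \<open>The rows hold \<open>2 * n\<close> particles together, so having \<open>n\<close> of
  each colour amounts to final height 0.\<close>

lemma complete_configs_iff:
  "(t, b) \<in> complete_configs n \<longleftrightarrow>
     length t = n \<and> length b = n \<and> nonneg 0 (zip t b) \<and> height (zip t b) = 0"
proof (cases "length t = n \<and> length b = n")
  case True
  have "count_list (take j t @ take j b) White \<le> count_list (take j t @ take j b) Black
      \<longleftrightarrow> 0 \<le> height (take j (zip t b))" for j
    using height_zip[of "take j t" "take j b"] True
    by (simp add: take_zip flip: of_nat_add)
  moreover have "count_list (t @ b) Black = n \<and> count_list (t @ b) White = n
      \<longleftrightarrow> height (zip t b) = 0"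
    using height_zip[of t b] count_Black_White[of "t @ b"] True by (auto simp del: count_list_append)
  ultimately show ?thesis
    using True unfolding complete_configs_def by (auto simp: nonneg_iff simp del: count_list_append)
qed (auto simp: complete_configs_def)

lemma finite_rows [simp]: "finite {xs :: particle list. length xs = n}"
proof -
  have "(UNIV :: particle set) = {Black, White}"
    using particle.exhaust by auto
  then have "finite (UNIV :: particle set)"
    by (metis finite.emptyI finite_insert)
  then show ?thesis
    using finite_lists_length_eq[of UNIV n] by simp
qed

lemma finite_configs: "finite (configs n)"
  by (simp add: configs_def)

lemma finite_complete_configs: "finite (complete_configs n)"
proof (rule finite_subset)
  show "complete_configs n \<subseteq> {xs. length xs = n} \<times> {xs. length xs = n}"
    by (auto simp: complete_configs_def)
qed simp

text \<open>A column with black top has height 0 or 2, so the path cannot fall there, whatever the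
  bottom block is.\<close>

lemma nonneg_replicate_Black:
  "length d = p \<Longrightarrow> 0 \<le> h \<Longrightarrow>
   nonneg h (zip (replicate p Black) d) \<and> 0 \<le> height (zip (replicate p Black) d)"
proof (induction d arbitrary: p h)
  case (Cons x d)
  then obtain q where q: "p = Suc q" "length d = q" by (cases p) auto
  have "0 \<le> h + wt Black + wt x" "0 \<le> wt Black + wt x"
    using Cons.prems by (cases x; simp)+
  then show ?case
    using q Cons.IH[of q "h + wt Black + wt x"] by auto
qed auto

section \<open>The exit wall\<close>

text \<open>In \<open>jump \<omega> i \<omega>' j\<close> one has \<open>\<omega>' = T \<omega> i\<close>; the exit wall \<open>j\<close> is \<open>j1\<close> in (a') and (c),
  \<open>j2\<close> in (a'') and (b), and \<open>i\<close> in (d). It is chosen so that \<open>(\<omega>', j)\<close> determines \<open>(\<omega>, i)\<close>.\<close>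

inductive jump :: "complete_config \<Rightarrow> nat \<Rightarrow> complete_config \<Rightarrow> nat \<Rightarrow> bool" where
  white_left:
    "\<lbrakk>u = [] \<or> last u = Black; length c = length u; length d = p; length e = length v\<rbrakk> \<Longrightarrow>
     jump (u @ replicate p White @ Black # White # v, c @ d @ x # Black # e) (length u + p + 1)
          (u @ White # replicate p White @ Black # v, c @ Black # d @ x # e) (length u)"
| black_right:
    "\<lbrakk>length c = length u; length d = p; length e = length v\<rbrakk> \<Longrightarrow>
     jump (u @ Black # White # replicate p Black @ White # v, c @ x # White # d @ y # e)
          (length u + 1)
          (u @ White # replicate p Black @ Black # White # v, c @ x # d @ y # White # e)
          (length u + p + 2)"
| black_right_end:
    "\<lbrakk>length c = length u; length d = p\<rbrakk> \<Longrightarrow>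
     jump (u @ Black # White # replicate p Black, c @ x # White # d) (length u + 1)
          (u @ White # replicate p Black @ [Black], c @ x # d @ [White]) (length u + p + 2)"
| enter:
    "\<lbrakk>length d = p; length e = length v\<rbrakk> \<Longrightarrow>
     jump (White # replicate p Black @ White # v, Black # d @ y # e) 0
          (replicate p Black @ Black # White # v, d @ y # White # e) (p + 1)"
| enter_end:
    "length d = p \<Longrightarrow>
     jump (White # replicate p Black, Black # d) 0
          (replicate p Black @ [Black], d @ [White]) (p + 1)"
| leave:
    "\<lbrakk>u = [] \<or> last u = Black; length c = length u; length d = p\<rbrakk> \<Longrightarrow>
     jump (u @ replicate p White @ [Black], c @ d @ [White]) (length u + p + 1)
          (u @ White # replicate p White, c @ Black # d) (length u)"
| stay:
    "\<lbrakk>t \<noteq> []; i \<le> length t; length b = length t;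
      i < length t \<Longrightarrow> t ! i = White \<Longrightarrow> 0 < i \<and> t ! (i - 1) = White;
      i = length t \<Longrightarrow> t ! (i - 1) = White\<rbrakk> \<Longrightarrow>
     jump (t, b) i (t, b) i"

text \<open>In \<open>white_left\<close> and \<open>leave\<close> only columns of height 0 are
  removed and inserted. In the black moves the block \<open>d\<close> stays under black cells, and
  the heights beyond the affected stretch are unchanged.\<close>

lemma jump_complete:
  assumes "jump \<omega> i \<omega>' j" "\<omega> \<in> complete_configs n"
  shows "\<omega>' \<in> complete_configs n"
  using assms
proof (induction rule: jump.induct)
  case (white_left u c d p e v x)
  then have "0 \<le> height (zip u c)"
    using nonneg_height[of 0 "zip u c"] by (simp add: complete_configs_iff)
  then show ?case using white_left by (auto simp: complete_configs_iff algebra_simps)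
next
  case (black_right c u d p e v x y)
  \<comment> \<open>The height of the old path after its column White over White equals the height
    of the new path after White over \<open>x\<close>.\<close>
  then have "0 \<le> height (zip u c) + wt Black + wt x - 2"
    by (auto simp: complete_configs_iff algebra_simps)
  then have A: "0 \<le> height (zip u c) - 1 + wt x" by simp
  have B: "0 \<le> wt y + 1" by (cases y) auto
  from nonneg_replicate_Black[of d p, OF black_right(2) A]
  show ?case using black_right A B
    by (auto simp: complete_configs_iff algebra_simps)
next
  case (black_right_end c u d p x)
  then have "0 \<le> height (zip u c) + wt Black + wt x - 2"
    by (auto simp: complete_configs_iff algebra_simps)
  then have A: "0 \<le> height (zip u c) - 1 + wt x" by simp
  from nonneg_replicate_Black[of d p, OF black_right_end(2) A]
  show ?case using black_right_end A
    by (auto simp: complete_configs_iff algebra_simps)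
next
  case (enter d p e v y)
  have B: "0 \<le> wt y + 1" by (cases y) auto
  from nonneg_replicate_Black[of d p, OF enter(1), of 0]
  show ?case using enter B
    by (auto simp: complete_configs_iff algebra_simps)
next
  case (enter_end d p)
  from nonneg_replicate_Black[of d p, OF enter_end(1), of 0]
  show ?case using enter_end
    by (auto simp: complete_configs_iff algebra_simps)
next
  case (leave u c d p)
  then have "0 \<le> height (zip u c)"
    using nonneg_height[of 0 "zip u c"] by (simp add: complete_configs_iff)
  then show ?case using leave by (auto simp: complete_configs_iff algebra_simps)
qed

lemma jump_le: "jump \<omega> i \<omega>' j \<Longrightarrow> j \<le> length (top_row \<omega>)"
  by (induction rule: jump.induct) auto

text \<open>In the top row a long jump looks like an exchange of neighbours, since the particle only
  passes cells of its own colour.\<close>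

lemma jump_top:
  "jump \<omega> i \<omega>' j \<Longrightarrow> top_row \<omega>' = tasep_move (top_row \<omega>) i"
proof (induction rule: jump.induct)
  case (white_left u c d p e v x)
  then show ?case
    by (simp add: tasep_move_def Let_def cell_def nth_append list_update_append replicate_append_same)
next
  case (black_right c u d p e v x y)
  then show ?case
    by (simp add: tasep_move_def Let_def cell_def nth_append list_update_append)
      (simp add: replicate_app_Cons_same)
next
  case (black_right_end c u d p x)
  then show ?case
    by (simp add: tasep_move_def Let_def cell_def nth_append list_update_append replicate_append_same)
next
  case (stay t i b)
  then show ?case
    by (cases "i = 0"; cases "i = length t") (auto simp: tasep_move_def Let_def cell_def)
qed (auto simp: tasep_move_def Let_def cell_def nth_append list_update_append replicate_append_same)

text \<open>The exit wall of a proper move has a black cell or the left border on its left and a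
  white cell or the right border on its right, which excludes \<open>stay\<close>. The bottom cell
  to its right decides the rest: black after a white move, white after a black one; at wall
  \<open>n\<close> only a black move can end. The monochromatic run of length \<open>p\<close> or
  \<open>q\<close> next to the wall leads back to the entry wall, a run reaching the border meaning
  \<open>leave\<close> or an entry.\<close>

definition unjump :: "complete_config \<Rightarrow> nat \<Rightarrow> complete_config \<times> nat" where
  "unjump \<omega> j =
    (let t = fst \<omega>; b = snd \<omega>; n = length t;
         p = length (takeWhile ((=) White) (drop (j + 1) t));
         q = length (takeWhile ((=) Black) (rev (take j t)));
         b' = (if j = n then take (n - 1) b else take j b @ drop (j + 1) b)
     in
     if j < n \<and> t ! j = White \<and> b ! j = Black \<and> (j = 0 \<or> t ! (j - 1) = Black) then
       if j + 1 + p = n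
       then ((take j t @ replicate p White @ [Black], take j b @ drop (j + 1) b @ [White]), n)
       else ((take j t @ replicate p White @ Black # White # drop (j + p + 2) t,
              take j b @ take (p + 1) (drop (j + 1) b) @ Black # drop (j + p + 2) b), j + p + 1)
     else if 0 < j \<and> t ! (j - 1) = Black \<and> (j = n \<or> t ! j = White \<and> b ! j = White) then
       if j = q then ((White # replicate (q - 1) Black @ drop j t, Black # b'), 0)
       else ((take (j - q - 1) t @ Black # White # replicate (q - 1) Black @ drop j t,
              take (j - q) b @ White # drop (j - q) b'), j - q)
     else (\<omega>, j))"

lemma takeWhile_replicate_append:
  "takeWhile P (replicate p x @ ys) = (if P x then replicate p x @ takeWhile P ys else if p = 0 then takeWhile P ys else [])"
  by (induction p) auto

lemma unjump_jump: "jump \<omega> i \<omega>' j \<Longrightarrow> unjump \<omega>' j = (\<omega>, i)"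
proof (induction rule: jump.induct)
  case (white_left u c d p e v x)
  then show ?case
    by (cases "u = []") (auto simp: unjump_def Let_def nth_append takeWhile_replicate_append last_conv_nth)
next
  case (black_right c u d p e v x y)
  then show ?case
    by (auto simp: numeral_3_eq_3 unjump_def Let_def nth_append takeWhile_replicate_append)
next
  case (black_right_end c u d p x)
  then show ?case
    by (auto simp: unjump_def Let_def nth_append takeWhile_replicate_append)
next
  case (enter d p e v y)
  then show ?case
    by (auto simp: unjump_def Let_def nth_append takeWhile_replicate_append)
next
  case (enter_end d p)
  then show ?case
    by (auto simp: unjump_def Let_def nth_append takeWhile_replicate_append)
next
  case (leave u c d p)
  then show ?case
    by (cases "u = []") (auto simp: unjump_def Let_def nth_append takeWhile_replicate_append last_conv_nth)
next
  case (stay t i b)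
  then show ?case
    by (auto simp: unjump_def Let_def)
qed

section \<open>Every step of \<open>T\<close> is a jump\<close>

lemma white_suffix:
  "\<exists>u p. xs = u @ replicate p White \<and> (u = [] \<or> last u = Black)"
proof (induction xs rule: rev_induct)
  case (snoc x xs)
  show ?case
  proof (cases x)
    case Black
    then show ?thesis by (intro exI[of _ "xs @ [x]"] exI[of _ 0]) simp
  next
    case White
    from snoc obtain u p where "xs = u @ replicate p White" "u = [] \<or> last u = Black"
      by blast
    then show ?thesis
      using White by (intro exI[of _ u] exI[of _ "Suc p"]) (simp add: replicate_append_same)
  qed
qed simp

lemma black_prefix:
  "\<exists>p v. xs = replicate p Black @ v \<and> (v = [] \<or> (\<exists>v'. v = White # v'))"
proof (induction xs)
  case (Cons x xs)
  show ?case
  proof (cases x)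
    case White
    then show ?thesis by (intro exI[of _ 0] exI[of _ "x # xs"]) simp
  next
    case Black
    from Cons obtain p v where "xs = replicate p Black @ v" "v = [] \<or> (\<exists>v'. v = White # v')"
      by blast
    then show ?thesis
      using Black by (intro exI[of _ "Suc p"] exI[of _ v]) simp
  qed
qed simp

text \<open>A smaller index would require the last cell of \<open>u\<close> to be white. The rest
  \<open>r\<close> is arbitrary so that (a') and (c) are both covered.\<close>

lemma j1_eq:
  assumes "u = [] \<or> last u = Black"
  shows "j1 (u @ replicate p White @ r) (Suc (length u + p)) = length u"
  unfolding j1_def
proof (rule Min_eqI)
  fix y
  assume y: "y \<in> {j \<in> {0..Suc (length u + p) - 1}. \<forall>c\<in>{j + 1..Suc (length u + p) - 1}.
    cell (u @ replicate p White @ r) c = White}"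
  show "length u \<le> y"
  proof (rule ccontr)
    assume "\<not> length u \<le> y"
    then have "cell (u @ replicate p White @ r) (length u) = White" "u \<noteq> []"
      using y by auto
    then show False
      using assms by (simp add: cell_def nth_append last_conv_nth)
  qed
qed (auto simp: cell_def nth_append)

lemma j2_eq:
  assumes "v = [] \<or> (\<exists>v'. v = White # v')" "length u = i"
  shows "j2 (u @ z # replicate p Black @ v) i = Suc (i + p)"
  unfolding j2_def
proof (rule Max_eqI)
  let ?t = "u @ z # replicate p Black @ v"
  fix y
  assume y: "y \<in> {j \<in> {i + 1..length ?t}. \<forall>c\<in>{i + 2..j}. cell ?t c = Black}"
  show "y \<le> Suc (i + p)"
  proof (rule ccontr)
    assume "\<not> y \<le> Suc (i + p)"
    then have "cell ?t (i + p + 2) = Black" "v \<noteq> []"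
      using y assms by auto
    then show False
      using assms by (auto simp: cell_def nth_append)
  qed
qed (use assms in \<open>auto simp: cell_def nth_append nth_Cons'\<close>)

lemma jump_T_left:
  assumes "(White # t, b) \<in> complete_configs n"
  shows "\<exists>j. jump (White # t, b) 0 (T (White # t, b) 0) j"
proof -
  obtain x b' where b: "b = x # b'"
    using assms by (cases b) (auto simp: complete_configs_iff)
  \<comment> \<open>White over White as first column would make the path negative.\<close>
  have x: "x = Black"
    using assms b by (cases x) (auto simp: complete_configs_iff)
  obtain p v where t: "t = replicate p Black @ v" "v = [] \<or> (\<exists>v'. v = White # v')"
    using black_prefix by blast
  note q = j2_eq[of v "[]" 0 White p, OF t(2)]
  have len: "length b' = p + length v"
    using assms b t by (auto simp: complete_configs_iff)
  show ?thesis
  proof (cases v)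
    case Nil
    then show ?thesis
      using enter_end[of b' p] len t x b q
      by (intro exI[of _ "p + 1"])
        (simp add: T_def Let_def cell_def insert_cell_def delete_cell_def)
  next
    case (Cons z v')
    then have v: "v = White # v'" using t by auto
    define d where "d = take p b'"
    obtain y e where e: "drop p b' = y # e"
      using len v by (cases "drop p b'") auto
    have "length (drop p b') = Suc (length e)"
      by (simp only: e list.size)
    with len v have "length e = length v'" by simp
    then have b': "b' = d @ y # e" "length d = p" "length e = length v'"
      using e d_def len v append_take_drop_id[of p b'] by auto
    show ?thesis
      using enter[of d p e v' y] t v x b b' q
      by (intro exI[of _ "p + 1"])
        (simp add: T_def Let_def cell_def insert_cell_def delete_cell_def)
  qed
qed

lemma jump_T_right:
  assumes "(t @ [Black], b) \<in> complete_configs n"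
  shows "\<exists>j. jump (t @ [Black], b) n (T (t @ [Black], b) n) j"
proof -
  have n: "n = Suc (length t)" using assms by (auto simp: complete_configs_iff)
  then obtain b' x where b: "b = b' @ [x]" "length b' = length t"
    using assms by (auto simp: complete_configs_iff length_Suc_conv_rev)
  \<comment> \<open>The last column ends a nonnegative path at height 0, so a black top forces a
    white bottom.\<close>
  have "0 \<le> height (zip t b')" "height (zip t b') + 1 + wt x = 0"
    using assms b nonneg_height[of 0 "zip t b'"] by (auto simp: complete_configs_iff)
  then have x: "x = White" by (cases x) auto
  obtain u p where t: "t = u @ replicate p White" "u = [] \<or> last u = Black"
    using white_suffix by blast
  define c d where "c = take (length u) b'" and "d = drop (length u) b'"
  have b': "b' = c @ d" "length c = length u" "length d = p"
    using b t by (auto simp: c_def d_def)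
  show ?thesis
    using leave[OF t(2) b'(2,3)] t(1) b x b' n j1_eq[OF t(2), of p "[Black]"]
    by (intro exI[of _ "length u"])
      (simp add: T_def Let_def cell_def insert_cell_def delete_cell_def nth_append)
qed

lemma jump_T_inner:
  assumes "length c0 = length t0" "length e0 = length t1"
    and "\<omega> = (t0 @ Black # White # t1, c0 @ x # z # e0)"
  shows "\<exists>j. jump \<omega> (length t0 + 1) (T \<omega> (length t0 + 1)) j"
proof (cases z)
  case Black
  obtain u p where t: "t0 = u @ replicate p White" "u = [] \<or> last u = Black"
    using white_suffix by blast
  define c d where "c = take (length u) c0" and "d = drop (length u) c0"
  have c0: "c0 = c @ d" "length c = length u" "length d = p"
    using assms t by (auto simp: c_def d_def)
  show ?thesis
    using white_left[OF t(2) c0(2,3) assms(2), of x] t(1) c0 assms Black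
      j1_eq[OF t(2), of p "Black # White # t1"]
    by (intro exI[of _ "length u"])
      (simp add: T_def Let_def cell_def insert_cell_def delete_cell_def nth_append)
next
  case White
  obtain p v where t: "t1 = replicate p Black @ v" "v = [] \<or> (\<exists>v'. v = White # v')"
    using black_prefix by blast
  note q = j2_eq[of v "t0 @ [Black]" "Suc (length t0)" White p, OF t(2)]
  show ?thesis
  proof (cases v)
    case Nil
    then show ?thesis
      using black_right_end[of c0 t0 e0 p x] t q assms White
      by (intro exI[of _ "length t0 + p + 2"])
        (simp add: T_def Let_def cell_def insert_cell_def delete_cell_def nth_append)
  next
    case (Cons w v')
    then have v: "v = White # v'" using t by auto
    define d where "d = take p e0"
    obtain y e where e: "drop p e0 = y # e"
      using assms(2) t v by (cases "drop p e0") auto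
    have "length (drop p e0) = Suc (length e)"
      by (simp only: e list.size)
    with assms(2) t v have "length e = length v'" by simp
    then have e0: "e0 = d @ y # e" "length d = p" "length e = length v'"
      using e d_def assms(2) t v append_take_drop_id[of p e0] by auto
    show ?thesis
      using black_right[of c0 t0 d p e v' x y] t v q e0 assms White
      by (intro exI[of _ "length t0 + p + 2"])
        (simp add: T_def Let_def cell_def insert_cell_def delete_cell_def nth_append)
  qed
qed

lemma jump_T:
  assumes "\<omega> \<in> complete_configs n" "1 \<le> n" "i \<le> n"
  shows "\<exists>j. jump \<omega> i (T \<omega> i) j"
proof -
  obtain t b where \<omega>: "\<omega> = (t, b)" by (cases \<omega>)
  have len: "length t = n" "length b = n"
    using assms \<omega> by (auto simp: complete_configs_iff)
  \<comment> \<open>These are (b), (c), (a') together with (a''), and (d).\<close>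
  consider "i = 0" "t ! 0 = White" | "i = n" "t ! (n - 1) = Black"
    | "1 \<le> i" "i \<le> n - 1" "t ! (i - 1) = Black" "t ! i = White"
    | "i < n \<Longrightarrow> t ! i = White \<Longrightarrow> 0 < i \<and> t ! (i - 1) = White" "i = n \<Longrightarrow> t ! (i - 1) = White"
  proof -
    have "\<not> (i = 0 \<and> t ! 0 = White) \<Longrightarrow> \<not> (i = n \<and> t ! (n - 1) = Black) \<Longrightarrow>
      \<not> (1 \<le> i \<and> i \<le> n - 1 \<and> t ! (i - 1) = Black \<and> t ! i = White) \<Longrightarrow>
      (i < n \<longrightarrow> t ! i = White \<longrightarrow> 0 < i \<and> t ! (i - 1) = White) \<and> (i = n \<longrightarrow> t ! (i - 1) = White)"
      using assms by (cases "t ! i"; cases "t ! (i - 1)"; cases "i = 0"; cases "i = n") auto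
    then show thesis using that by blast
  qed
  then show ?thesis
  proof cases
    case 1
    obtain t' where "t = White # t'"
      using 1 assms len by (cases t) auto
    then show ?thesis using jump_T_left[of t' b n] assms \<omega> 1 by simp
  next
    case 2
    then obtain t' where "t = t' @ [Black]"
      using assms len by (cases t rule: rev_cases) auto
    then show ?thesis using jump_T_right[of t' b n] assms \<omega> 2 by simp
  next
    case 3
    have *: "take (i - 1) xs @ xs ! (i - 1) # xs ! i # drop (i + 1) xs = xs"
      if "length xs = n" for xs :: config
      using that 3 Cons_nth_drop_Suc[of i xs] id_take_nth_drop[of "i - 1" xs, symmetric] by simp
    have "take (i - 1) t @ Black # White # drop (i + 1) t = t"
      using *[of t] 3 len by simp
    then have "\<omega> = (take (i - 1) t @ Black # White # drop (i + 1) t,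
        take (i - 1) b @ b ! (i - 1) # b ! i # drop (i + 1) b)"
      using *[of b] \<omega> len by simp
    from jump_T_inner[OF _ _ this] show ?thesis
      using 3 len by simp
  next
    case 4
    then have "T \<omega> i = \<omega>"
      using \<omega> len assms by (cases "i = n"; cases "i = 0") (auto simp: T_def Let_def cell_def)
    moreover have "jump \<omega> i \<omega> i"
      unfolding \<omega> using 4 len assms by (intro stay) auto
    ultimately show ?thesis by metis
  qed
qed

section \<open>Uniformity is preserved\<close>

lemma T_complete:
  "\<omega> \<in> complete_configs n \<Longrightarrow> 1 \<le> n \<Longrightarrow> i \<le> n \<Longrightarrow> T \<omega> i \<in> complete_configs n"
  using jump_T jump_complete by blast

lemma top_T:
  "\<omega> \<in> complete_configs n \<Longrightarrow> 1 \<le> n \<Longrightarrow> i \<le> n \<Longrightarrow> top_row (T \<omega> i) = tasep_move (top_row \<omega>) i"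
  using jump_T jump_top by blast

text \<open>Recording the exit wall makes \<open>T\<close> an injective, hence bijective, self-map of
  \<open>complete_configs n \<times> {0..n}\<close>; so every complete configuration has exactly \<open>n + 1\<close>
  preimages under \<open>T\<close>.\<close>

lemma sum_T:
  fixes g :: "complete_config \<Rightarrow> real"
  assumes "1 \<le> n"
  shows "(\<Sum>\<omega>\<in>complete_configs n. \<Sum>i\<le>n. g (T \<omega> i)) = (real n + 1) * (\<Sum>\<omega>\<in>complete_configs n. g \<omega>)"
proof -
  let ?\<Omega> = "complete_configs n"
  \<comment> \<open>\<open>unjump_jump\<close> makes \<open>F\<close> injective whichever exit wall
    is selected.\<close>
  define F where "F = (\<lambda>(\<omega>, i). (T \<omega> i, SOME j. jump \<omega> i (T \<omega> i) j))"
  have jump: "jump (fst x) (snd x) (fst (F x)) (snd (F x))" if "x \<in> ?\<Omega> \<times> {..n}" for x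
    using that jump_T[of "fst x" n "snd x"] assms
    by (auto simp: F_def case_prod_unfold intro: someI_ex simp del: split_paired_Ex)
  have inj: "inj_on F (?\<Omega> \<times> {..n})"
    by (rule inj_onI) (metis jump unjump_jump prod.collapse)
  have "F x \<in> ?\<Omega> \<times> {..n}" if "x \<in> ?\<Omega> \<times> {..n}" for x
    using jump_complete[OF jump[OF that]] jump_le[OF jump[OF that]] that
    by (auto simp: complete_configs_def mem_Times_iff)
  then have "F ` (?\<Omega> \<times> {..n}) \<subseteq> ?\<Omega> \<times> {..n}" by blast
  then have "F ` (?\<Omega> \<times> {..n}) = ?\<Omega> \<times> {..n}"
    by (intro endo_inj_surj inj) (simp_all add: finite_complete_configs)
  then have bij: "bij_betw F (?\<Omega> \<times> {..n}) (?\<Omega> \<times> {..n})"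
    using inj by (simp add: bij_betw_def)
  have "(\<Sum>\<omega>\<in>?\<Omega>. \<Sum>i\<le>n. g (T \<omega> i)) = (\<Sum>x\<in>?\<Omega> \<times> {..n}. g (fst (F x)))"
    by (simp add: sum.cartesian_product F_def case_prod_unfold)
  also have "\<dots> = (\<Sum>x\<in>?\<Omega> \<times> {..n}. g (fst x))"
    using sum.reindex_bij_betw[OF bij, of "\<lambda>x. g (fst x)"] .
  also have "\<dots> = (\<Sum>\<omega>\<in>?\<Omega>. \<Sum>i\<le>n. g \<omega>)"
    unfolding sum.cartesian_product by (simp only: case_prod_unfold)
  finally show ?thesis
    by (simp add: sum_distrib_left add.commute)
qed

section \<open>Counting complete configurations\<close>

definition paths :: "nat \<Rightarrow> int \<Rightarrow> int \<Rightarrow> complete_config set" where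
  "paths n a b = {(t, c). length t = n \<and> length c = n \<and> nonneg 0 (zip t c) \<and>
     int (count_list t Black) = a \<and> int (count_list c White) = b}"

text \<open>Extended by 0 to negative lower index, so that Pascal's rule and the shifts in the path
  recurrence hold at the boundary too.\<close>

definition choose_int :: "nat \<Rightarrow> int \<Rightarrow> int" where
  "choose_int n k = (if k < 0 then 0 else int (n choose nat k))"

lemma choose_int_Suc: "choose_int (Suc n) k = choose_int n k + choose_int n (k - 1)"
proof (cases "k \<le> 0")
  case True
  then show ?thesis by (cases "k = 0") (auto simp: choose_int_def)
next
  case False
  then have "nat k = Suc (nat (k - 1))" by simp
  then show ?thesis using False by (simp add: choose_int_def)
qed

lemma finite_paths: "finite (paths n a b)"
proof (rule finite_subset)
  show "paths n a b \<subseteq> {xs. length xs = n} \<times> {xs. length xs = n}"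
    by (auto simp: paths_def)
qed simp

text \<open>A top cell contributes \<open>2 * [Black] - 1\<close> and a bottom cell
  \<open>1 - 2 * [White]\<close>; the constants cancel column by column.\<close>

lemma height_zip_diff:
  "length t = length c \<Longrightarrow>
   height (zip t c) = 2 * (int (count_list t Black) - int (count_list c White))"
proof (induction t c rule: list_induct2)
  case (Cons x xs y ys)
  then show ?case by (cases x; cases y) auto
qed simp

lemma paths_empty:
  assumes "a < b"
  shows "paths n a b = {}"
proof -
  have False if "(t, c) \<in> paths n a b" for t c
    using that assms nonneg_iff[of 0 "zip t c"] height_zip_diff[of t c]
    by (force simp: paths_def)
  then show ?thesis by auto
qed

definition add_column :: "particle \<Rightarrow> particle \<Rightarrow> complete_config \<Rightarrow> complete_config" where
  "add_column x y \<omega> = (fst \<omega> @ [x], snd \<omega> @ [y])"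

lemma inj_add_column: "inj_on (add_column x y) A"
  by (auto simp: inj_on_def add_column_def prod_eq_iff)

lemma ex_particle: "(\<exists>x. P x) \<longleftrightarrow> P Black \<or> P White"
  by (metis particle.exhaust)

text \<open>Removing the last column drops just one prefix condition, nonnegativity of the final
  height, and \<open>b \<le> a\<close> restores it.\<close>

lemma paths_Suc:
  assumes "b \<le> a"
  shows "paths (Suc n) a b =
    add_column Black White ` paths n (a - 1) (b - 1) \<union>
    add_column Black Black ` paths n (a - 1) b \<union>
    add_column White White ` paths n a (b - 1) \<union>
    add_column White Black ` paths n a b" (is "_ = ?R")
proof (rule set_eqI)
  fix \<omega> :: complete_config
  obtain t c where \<omega>: "\<omega> = (t, c)" by (cases \<omega>)
  show "\<omega> \<in> paths (Suc n) a b \<longleftrightarrow> \<omega> \<in> ?R"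
  proof
    assume A: "\<omega> \<in> paths (Suc n) a b"
    then have "length t = Suc n" "length c = Suc n" using \<omega> by (auto simp: paths_def)
    then obtain t' x c' y where tc: "t = t' @ [x]" "c = c' @ [y]" "length t' = n" "length c' = n"
      by (metis length_Suc_conv_rev)
    have "(t', c') \<in> paths n (a - (if x = Black then 1 else 0)) (b - (if y = White then 1 else 0))"
      using A \<omega> tc by (auto simp: paths_def)
    moreover have "\<omega> = add_column x y (t', c')"
      using \<omega> tc by (simp add: add_column_def)
    ultimately show "\<omega> \<in> ?R"
      by (cases x; cases y) auto
  next
    have *: "add_column x y (t', c') \<in> paths (Suc n) a b"
      if "(t', c') \<in> paths n (a - (if x = Black then 1 else 0)) (b - (if y = White then 1 else 0))"
      for x y t' c'
      using that assms height_zip_diff[of t' c'] height_zip_diff[of "t' @ [x]" "c' @ [y]"]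
      by (auto simp: paths_def add_column_def split: if_splits)
    assume "\<omega> \<in> ?R"
    then have "\<exists>x y. \<omega> \<in> add_column x y `
        paths n (a - (if x = Black then 1 else 0)) (b - (if y = White then 1 else 0))"
      by (simp add: ex_particle) blast
    then show "\<omega> \<in> paths (Suc n) a b"
      using * by fast
  qed
qed

text \<open>The count is a two-by-two Lindstroem--Gessel--Viennot determinant. It vanishes on
  the line \<open>a = b - 1\<close> just outside the admissible region, so the recurrence closes up.\<close>

lemma card_paths:
  "b - 1 \<le> a \<Longrightarrow> int (card (paths n a b)) =
     choose_int n a * choose_int n b - choose_int n (a + 1) * choose_int n (b - 1)"
proof (induction n arbitrary: a b)
  case 0
  have "paths 0 a b = (if a = 0 \<and> b = 0 then {([], [])} else {})"
    by (auto simp: paths_def)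
  moreover have "choose_int 0 k = (if k = 0 then 1 else 0)" for k
    by (auto simp: choose_int_def)
  ultimately show ?case using 0 by auto
next
  case (Suc n)
  show ?case
  proof (cases "b \<le> a")
    case False
    then have "a = b - 1" using Suc.prems by simp
    then show ?thesis by (simp add: paths_empty)
  next
    case True
    have "card (paths (Suc n) a b) =
        card (paths n (a - 1) (b - 1)) + card (paths n (a - 1) b) +
        card (paths n a (b - 1)) + card (paths n a b)"
    proof -
      have disj: "add_column x y ` P \<inter> add_column x' y' ` Q = {}"
        if "(x, y) \<noteq> (x', y')" for x y x' y' P Q
        using that by (auto simp: add_column_def)
      show ?thesis
        by (simp add: paths_Suc[OF True] card_Un_disjoint finite_paths disj Int_Un_distrib2
            card_image inj_add_column)
    qed
    then have "int (card (paths (Suc n) a b)) =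
        int (card (paths n (a - 1) (b - 1))) + int (card (paths n (a - 1) b)) +
        int (card (paths n a (b - 1))) + int (card (paths n a b))"
      by simp
    also have "\<dots> = choose_int (Suc n) a * choose_int (Suc n) b
        - choose_int (Suc n) (a + 1) * choose_int (Suc n) (b - 1)"
      using True by (simp add: Suc.IH choose_int_Suc algebra_simps)
    finally show ?thesis .
  qed
qed

lemma complete_configs_with_eq_paths:
  "complete_configs_with k m = paths (k + m) (int k) (int k)"
proof -
  have "(t, c) \<in> complete_configs_with k m \<longleftrightarrow> (t, c) \<in> paths (k + m) (int k) (int k)" for t c
  proof (cases "length t = k + m \<and> length c = k + m")
    case True
    then have "height (zip t c) = 0 \<longleftrightarrow> count_list t Black = count_list c White"
      using height_zip_diff[of t c] by simp
    moreover have "count_list t White = m \<longleftrightarrow> count_list t Black = k"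
      using count_Black_White[of t] True by linarith
    ultimately show ?thesis
      using True by (simp add: complete_configs_with_def complete_configs_iff paths_def) metis
  qed (auto simp: complete_configs_with_def complete_configs_iff paths_def)
  then show ?thesis by auto
qed

text \<open>The Narayana number with its denominator cleared. The path determinant at
  \<open>a = b = k\<close> is \<open>A * A - B * C\<close>, and absorption relates both neighbours
  \<open>B\<close>, \<open>C\<close> to \<open>A\<close>.\<close>

lemma card_complete_configs_with:
  "(real (k + m) + 1) * real (card (complete_configs_with k m)) =
     real ((k + m + 1) choose k) * real ((k + m + 1) choose m)"
proof -
  define n where "n = k + m"
  define A where "A = real (n choose k)"
  define B where "B = real (n choose (k + 1))"
  \<comment> \<open>At \<open>k = 0\<close> truncated subtraction would give
    \<open>n choose 0 = 1\<close>, whereas \<open>choose_int\<close> vanishes at -1.\<close>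
  define C where "C = (if k = 0 then 0 else real (n choose (k - 1)))"
  have "int (card (complete_configs_with k m)) =
      int (n choose k) * int (n choose k) - int (n choose (k + 1)) * (if k = 0 then 0 else int (n choose (k - 1)))"
    unfolding complete_configs_with_eq_paths
    by (subst card_paths) (auto simp: choose_int_def n_def nat_add_distrib nat_diff_distrib)
  then have "real_of_int (int (card (complete_configs_with k m))) = A * A - B * C"
    unfolding A_def B_def C_def by simp
  then have card: "real (card (complete_configs_with k m)) = A * A - B * C" by simp
  have ab: "real (k + 1) * B = real m * A"
  proof -
    have "Suc k * (n choose Suc k) = (n - k) * (n choose k)"
      by (metis binomial_absorption binomial_absorb_comp)
    also have "n - k = m" by (simp add: n_def)
    finally have "real (Suc k * (n choose Suc k)) = real (m * (n choose k))" by (simp add: n_def)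
    then show ?thesis unfolding A_def B_def by (simp only: of_nat_mult Suc_eq_plus1)
  qed
  have ca: "real (m + 1) * C = real k * A"
  proof (cases k)
    case (Suc k')
    have "Suc k' * (n choose Suc k') = (n - k') * (n choose k')"
      by (metis binomial_absorption binomial_absorb_comp)
    also have "n - k' = m + 1" by (simp add: n_def Suc)
    finally have "real (Suc k' * (n choose Suc k')) = real ((m + 1) * (n choose k'))" 
      by (simp add: n_def Suc)
    then show ?thesis unfolding A_def C_def Suc by (simp only: of_nat_mult Suc_eq_plus1) simp
  qed (simp add: C_def)
  have l: "real ((n + 1) choose k) = A + C"
    by (cases k) (auto simp: A_def C_def)
  have "(n + 1) choose m = (n + 1) choose (k + 1)"
    using binomial_symmetric[of m "n + 1"] by (simp add: n_def)
  then have r: "real ((n + 1) choose m) = A + B"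
    by (simp add: A_def B_def)
  \<comment> \<open>Substituting for \<open>x * A\<close> and \<open>y * A\<close> turns the left
    side into \<open>A * A + A * B + A * C + B * C\<close>, without any division.\<close>
  have "(x + 1) * B = y * A \<Longrightarrow> (y + 1) * C = x * A \<Longrightarrow>
      (x + y + 1) * (A * A - B * C) = (A + C) * (A + B)" for x y
    by algebra
  from this[of "real k" "real m"] have "(real k + real m + 1) * (A * A - B * C) = (A + C) * (A + B)"
    using ab ca by (simp add: add_ac)
  then show ?thesis
    unfolding card using l r by (simp add: n_def)
qed

section \<open>The averaging operator\<close>

text \<open>The transition operator at rates 1, acting on test functions rather than on
  laws.\<close>

definition avg_step :: "('s \<Rightarrow> nat \<Rightarrow> 's) \<Rightarrow> nat \<Rightarrow> ('s \<Rightarrow> real) \<Rightarrow> 's \<Rightarrow> real" where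
  "avg_step move n f x = (\<Sum>i\<le>n. f (move x i)) / (real n + 1)"

text \<open>At rate 1 the acceptance coin is deterministic and only the uniform choice of the wall
  remains.\<close>

lemma pmf_wall_kernel:
  "pmf (wall_kernel move 1 1 1 n x) y = (\<Sum>i\<le>n. if move x i = y then 1 else 0) / (real n + 1)"
proof -
  have "bernoulli_pmf 1 = return_pmf True"
    by (intro pmf_eqI) (auto simp: indicator_def split: bool.splits)
  moreover have "wall_rate 1 1 1 n i = 1" for i
    by (simp add: wall_rate_def)
  ultimately have "wall_kernel move 1 1 1 n x = map_pmf (move x) (pmf_of_set {..n})"
    by (simp add: wall_kernel_def bind_return_pmf map_pmf_def atLeast0AtMost)
  then show ?thesis
    by (simp add: pmf_map measure_pmf_of_set sum.If_cases Int_def vimage_def)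
qed

text \<open>Synchronous coupling: both points use the same wall, so the two averages are compared
  term by term.\<close>

lemma avg_step_mono_diff:
  assumes closed: "\<And>x i. x \<in> A \<Longrightarrow> i \<le> n \<Longrightarrow> move x i \<in> A"
    and osc: "\<And>x y. x \<in> A \<Longrightarrow> y \<in> A \<Longrightarrow> \<bar>f x - f y\<bar> \<le> c"
    and xy: "x \<in> A" "y \<in> A"
  shows "\<bar>avg_step move n f x - avg_step move n f y\<bar> \<le> c"
proof -
  have "\<bar>(\<Sum>i\<le>n. f (move x i)) - (\<Sum>i\<le>n. f (move y i))\<bar> \<le> (\<Sum>i\<le>n. \<bar>f (move x i) - f (move y i)\<bar>)"
    unfolding sum_subtractf[symmetric] by (rule sum_abs)
  also have "\<dots> \<le> (\<Sum>i\<le>n. c)"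
    using assms by (intro sum_mono) auto
  finally show ?thesis
    by (simp add: avg_step_def field_simps flip: diff_divide_distrib)
qed

lemma funpow_avg_step_mono_diff:
  assumes "\<And>x i. x \<in> A \<Longrightarrow> i \<le> n \<Longrightarrow> move x i \<in> A"
    and "\<And>x y. x \<in> A \<Longrightarrow> y \<in> A \<Longrightarrow> \<bar>f x - f y\<bar> \<le> c"
    and "x \<in> A" "y \<in> A"
  shows "\<bar>(avg_step move n ^^ t) f x - (avg_step move n ^^ t) f y\<bar> \<le> c"
  using assms(3,4)
proof (induction t arbitrary: x y)
  case (Suc t)
  then show ?case
    using avg_step_mono_diff[of A n move "(avg_step move n ^^ t) f" c x y] assms(1) by auto
qed (use assms(2) in auto)

text \<open>Two starting points driven by the same random word of walls have merged as soon as
  this word is \<open>w\<close>, which has probability \<open>1 / (n + 1) ^ length w\<close>.\<close>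

lemma funpow_avg_step_merge:
  assumes closed: "\<And>x i. x \<in> A \<Longrightarrow> i \<le> n \<Longrightarrow> move x i \<in> A"
    and osc: "\<And>x y. x \<in> A \<Longrightarrow> y \<in> A \<Longrightarrow> \<bar>f x - f y\<bar> \<le> c"
    and "set w \<subseteq> {..n}" "foldl move x w = foldl move y w" "x \<in> A" "y \<in> A"
  shows "\<bar>(avg_step move n ^^ length w) f x - (avg_step move n ^^ length w) f y\<bar>
    \<le> c * (1 - 1 / (real n + 1) ^ length w)"
  using assms(3-)
proof (induction w arbitrary: x y)
  case (Cons i w)
  let ?g = "(avg_step move n ^^ length w) f"
  let ?q = "1 / (real n + 1) ^ length w"
  let ?d = "\<lambda>k. \<bar>?g (move x k) - ?g (move y k)\<bar>"
  have i: "i \<in> {..n}" using Cons.prems by auto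
  have "\<bar>(\<Sum>k\<le>n. ?g (move x k)) - (\<Sum>k\<le>n. ?g (move y k))\<bar> \<le> (\<Sum>k\<le>n. ?d k)"
    unfolding sum_subtractf[symmetric] by (rule sum_abs)
  also have "\<dots> = ?d i + (\<Sum>k\<in>{..n} - {i}. ?d k)"
    using i by (intro sum.remove) auto
  \<comment> \<open>Only the wall \<open>i\<close> profits from the rest of the word; each of the
    other \<open>n\<close> walls costs at most \<open>c\<close>.\<close>
  also have "\<dots> \<le> c * (1 - ?q) + (\<Sum>k\<in>{..n} - {i}. c)"
    using Cons closed i
    by (intro add_mono sum_mono Cons.IH funpow_avg_step_mono_diff[of A] osc) auto
  also have "\<dots> = (real n + 1) * c - c * ?q"
    using i by (simp add: algebra_simps of_nat_diff)
  finally have "\<bar>avg_step move n ?g x - avg_step move n ?g y\<bar> \<le> ((real n + 1) * c - c * ?q) / (real n + 1)"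
    by (simp add: avg_step_def divide_right_mono flip: diff_divide_distrib)
  also have "\<dots> = c * (1 - 1 / (real n + 1) ^ length (i # w))"
    by (simp add: divide_simps) (simp add: algebra_simps)
  finally show ?case by simp
qed (use osc in auto)

text \<open>After each block of \<open>length w\<close> steps the function satisfies the oscillation
  bound with a smaller constant, so the merging estimate can be iterated.\<close>

lemma funpow_avg_step_contract:
  assumes closed: "\<And>x i. x \<in> A \<Longrightarrow> i \<le> n \<Longrightarrow> move x i \<in> A"
    and w: "set w \<subseteq> {..n}" "\<And>x. x \<in> A \<Longrightarrow> foldl move x w = z"
    and osc: "\<And>x y. x \<in> A \<Longrightarrow> y \<in> A \<Longrightarrow> \<bar>f x - f y\<bar> \<le> c"
    and xy: "x \<in> A" "y \<in> A"
  shows "\<bar>(avg_step move n ^^ (length w * s)) f x - (avg_step move n ^^ (length w * s)) f y\<bar>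
    \<le> c * (1 - 1 / (real n + 1) ^ length w) ^ s"
  using xy
proof (induction s arbitrary: x y)
  case (Suc s)
  have "\<bar>(avg_step move n ^^ length w) ((avg_step move n ^^ (length w * s)) f) x
      - (avg_step move n ^^ length w) ((avg_step move n ^^ (length w * s)) f) y\<bar>
    \<le> c * (1 - 1 / (real n + 1) ^ length w) ^ s * (1 - 1 / (real n + 1) ^ length w)"
    using Suc w by (intro funpow_avg_step_merge[of A] closed) auto
  then show ?case
    by (simp add: funpow_add mult_ac)
qed (use osc in auto)

text \<open>The decay is geometric along multiples of \<open>length w\<close>, and the steps in
  between cannot increase the oscillation.\<close>

lemma funpow_avg_step_osc_tendsto_0:
  assumes closed: "\<And>x i. x \<in> A \<Longrightarrow> i \<le> n \<Longrightarrow> move x i \<in> A"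
    and w: "set w \<subseteq> {..n}" "\<And>x. x \<in> A \<Longrightarrow> foldl move x w = z"
    and osc: "\<And>x y. x \<in> A \<Longrightarrow> y \<in> A \<Longrightarrow> \<bar>f x - f y\<bar> \<le> c"
    and e: "0 < (e :: real)"
  shows "\<forall>\<^sub>F t in sequentially. \<forall>x\<in>A. \<forall>y\<in>A.
    \<bar>(avg_step move n ^^ t) f x - (avg_step move n ^^ t) f y\<bar> \<le> e"
proof -
  let ?r = "1 - 1 / (real n + 1) ^ length w"
  have "0 \<le> ?r" "?r < 1"
    by (simp_all add: divide_le_eq_1 one_le_power)
  then have "(\<lambda>s. c * ?r ^ s) \<longlonglongrightarrow> c * 0"
    by (intro tendsto_mult_left LIMSEQ_realpow_zero) auto
  then have "\<forall>\<^sub>F s in sequentially. c * ?r ^ s < e"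
    using e by (intro order_tendstoD(2)) auto
  then obtain s where s: "c * ?r ^ s < e"
    using eventually_happens' sequentially_bot by blast
  have "\<bar>(avg_step move n ^^ t) f x - (avg_step move n ^^ t) f y\<bar> \<le> e"
    if "length w * s \<le> t" "x \<in> A" "y \<in> A" for t x y
  proof -
    have "\<bar>(avg_step move n ^^ (t - length w * s)) ((avg_step move n ^^ (length w * s)) f) x
        - (avg_step move n ^^ (t - length w * s)) ((avg_step move n ^^ (length w * s)) f) y\<bar> \<le> c * ?r ^ s"
      using that w osc
      by (intro funpow_avg_step_mono_diff[of A] funpow_avg_step_contract[of A] closed) auto
    moreover have "(avg_step move n ^^ (t - length w * s)) ((avg_step move n ^^ (length w * s)) f)
        = (avg_step move n ^^ t) f"
      using that by (simp flip: funpow_add comp_apply[of "avg_step move n ^^ _"])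
    ultimately show ?thesis using s by simp
  qed
  then show ?thesis
    by (intro eventually_sequentiallyI[of "length w * s"]) auto
qed

section \<open>Finite Markov chains\<close>

text \<open>The Markov property is stated for full histories of positive probability. The one-step
  law follows by summing over all histories up to \<open>t\<close> and grouping them by their last
  state; for null histories both sides vanish.\<close>

lemma prob_Suc:
  assumes M: "markov_chain M A K Z" and A: "finite A"
  shows "\<P>(w in M. Z (Suc t) w = y) = (\<Sum>z\<in>A. \<P>(w in M. Z t w = z) * pmf (K z) y)"
proof -
  interpret prob_space M using M by (simp add: markov_chain_def)
  have Z[measurable]: "Z s \<in> measurable M (count_space A)" for s
    using M by (simp add: markov_chain_def)
  have ZA: "Z s w \<in> A" if "w \<in> space M" for s w
    using measurable_space[OF Z that] by simp
  have ev [measurable]: "{w \<in> space M. Z s w = x} \<in> events" for s x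
  proof -
    have "{w \<in> space M. Z s w = x} = Z s -` ({x} \<inter> A) \<inter> space M"
      using ZA by auto
    then show ?thesis using measurable_sets[OF Z, of "{x} \<inter> A"] by simp
  qed
  \<comment> \<open>Extensional functions, so that exactly one of them describes a given trajectory
    up to time \<open>t\<close>.\<close>
  let ?H = "PiE {..t} (\<lambda>_. A)"
  define hist where "hist x w \<longleftrightarrow> (\<forall>s\<le>t. Z s w = x s)" for x w
  have evh [measurable]: "{w \<in> space M. hist x w} \<in> events" for x
    unfolding hist_def by measurable
  have fin: "finite ?H" using A by (intro finite_PiE) auto
  have ex1: "\<exists>!x. x \<in> ?H \<and> hist x w" if "w \<in> space M" for w
  proof (rule ex1I[of _ "restrict (\<lambda>s. Z s w) {..t}"])
    fix x assume "x \<in> ?H \<and> hist x w"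
    then show "x = restrict (\<lambda>s. Z s w) {..t}"
      by (auto simp: hist_def fun_eq_iff PiE_def extensional_def)
  qed (use ZA[OF that] in \<open>auto simp: hist_def\<close>)
  have split: "\<P>(w in M. Q w) = (\<Sum>x\<in>?H. \<P>(w in M. Q w \<and> hist x w))"
    if [measurable]: "{w \<in> space M. Q w} \<in> events" for Q
    by (rule prob_sum) (use fin ex1 in \<open>auto intro!: AE_I2\<close>)
  have step: "\<P>(w in M. Z (Suc t) w = y \<and> hist x w) = \<P>(w in M. hist x w) * pmf (K (x t)) y" for x
  proof (cases "\<P>(w in M. hist x w) = 0")
    case True
    have "\<P>(w in M. Z (Suc t) w = y \<and> hist x w) \<le> \<P>(w in M. hist x w)"
      by (intro finite_measure_mono) auto
    then show ?thesis using True by (simp add: measure_le_0_iff)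
  next
    case False
    then have "\<P>(w in M. Z (Suc t) w = y \<bar> hist x w) = pmf (K (x t)) y"
      using M by (simp add: markov_chain_def hist_def)
    then show ?thesis using False by (simp add: cond_prob_def field_simps)
  qed
  have last: "\<P>(w in M. Z t w = z) = (\<Sum>x\<in>?H. if x t = z then \<P>(w in M. hist x w) else 0)" for z
  proof -
    have "\<P>(w in M. Z t w = z \<and> hist x w) = (if x t = z then \<P>(w in M. hist x w) else 0)" for x
    proof (cases "x t = z")
      case True
      then have "(Z t w = z \<and> hist x w) = hist x w" for w by (auto simp: hist_def)
      then show ?thesis using True by simp
    next
      case False
      then have "{w \<in> space M. Z t w = z \<and> hist x w} = {}" by (auto simp: hist_def)
      then show ?thesis using False by (simp only: if_False measure_empty)
    qed
    then show ?thesis using split[of "\<lambda>w. Z t w = z"] by simp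
  qed
  have "\<P>(w in M. Z (Suc t) w = y) = (\<Sum>x\<in>?H. \<P>(w in M. hist x w) * pmf (K (x t)) y)"
    using split[of "\<lambda>w. Z (Suc t) w = y"] step by simp
  also have "\<dots> = (\<Sum>x\<in>?H. \<Sum>z\<in>A. if x t = z then \<P>(w in M. hist x w) * pmf (K z) y else 0)"
    using A by (intro sum.cong refl) (auto simp: PiE_iff)
  also have "\<dots> = (\<Sum>z\<in>A. \<Sum>x\<in>?H. if x t = z then \<P>(w in M. hist x w) * pmf (K z) y else 0)"
    by (rule sum.swap)
  also have "\<dots> = (\<Sum>z\<in>A. \<P>(w in M. Z t w = z) * pmf (K z) y)"
    unfolding last sum_distrib_right by (intro sum.cong refl) auto
  finally show ?thesis .
qed

definition mean :: "'w measure \<Rightarrow> 's set \<Rightarrow> ('w \<Rightarrow> 's) \<Rightarrow> ('s \<Rightarrow> real) \<Rightarrow> real" where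
  "mean M A Y f = (\<Sum>y\<in>A. \<P>(w in M. Y w = y) * f y)"

text \<open>Duality: advancing the law by one step is the same as averaging the test function
  once.\<close>

lemma mean_Suc:
  assumes M: "markov_chain M A (wall_kernel move 1 1 1 n) Z" and A: "finite A"
    and closed: "\<And>x i. x \<in> A \<Longrightarrow> i \<le> n \<Longrightarrow> move x i \<in> A"
  shows "mean M A (Z (Suc t)) f = mean M A (Z t) (avg_step move n f)"
proof -
  have "(\<Sum>y\<in>A. pmf (wall_kernel move 1 1 1 n z) y * f y) = avg_step move n f z" if "z \<in> A" for z
  proof -
    have "(\<Sum>y\<in>A. pmf (wall_kernel move 1 1 1 n z) y * f y)
        = (\<Sum>y\<in>A. \<Sum>i\<le>n. (if move z i = y then f y else 0)) / (real n + 1)"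
      unfolding pmf_wall_kernel sum_divide_distrib sum_distrib_right
      by (intro sum.cong refl) auto
    also have "(\<Sum>y\<in>A. \<Sum>i\<le>n. (if move z i = y then f y else 0)) = (\<Sum>i\<le>n. \<Sum>y\<in>A. (if move z i = y then f y else 0))"
      by (rule sum.swap)
    also have "\<dots> = (\<Sum>i\<le>n. f (move z i))"
      using A closed[OF that] by (intro sum.cong refl) auto
    finally show ?thesis by (simp add: avg_step_def)
  qed
  then have "mean M A (Z t) (avg_step move n f)
      = (\<Sum>z\<in>A. \<P>(w in M. Z t w = z) * (\<Sum>y\<in>A. pmf (wall_kernel move 1 1 1 n z) y * f y))"
    unfolding mean_def by (intro sum.cong refl) auto
  also have "\<dots> = (\<Sum>z\<in>A. \<Sum>y\<in>A. \<P>(w in M. Z t w = z) * (pmf (wall_kernel move 1 1 1 n z) y * f y))"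
    by (simp only: sum_distrib_left)
  also have "\<dots> = mean M A (Z (Suc t)) f"
    unfolding mean_def prob_Suc[OF M A] sum_distrib_right
    by (subst sum.swap) (simp add: mult_ac)
  finally show ?thesis by simp
qed

lemma mean_funpow:
  assumes "markov_chain M A (wall_kernel move 1 1 1 n) Z" "finite A"
    and "\<And>x i. x \<in> A \<Longrightarrow> i \<le> n \<Longrightarrow> move x i \<in> A"
  shows "mean M A (Z t) f = mean M A (Z 0) ((avg_step move n ^^ t) f)"
proof (induction t arbitrary: f)
  case (Suc t)
  then show ?case
    by (simp add: mean_Suc[OF assms] funpow_swap1)
qed simp

lemma mean_indicator:
  assumes M: "prob_space M" and Y: "Y \<in> measurable M (count_space A)" and A: "finite A"
  shows "\<P>(w in M. Q (Y w)) = mean M A Y (\<lambda>y. if Q y then 1 else 0)"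
proof -
  interpret prob_space M by (rule M)
  have YA: "Y w \<in> A" if "w \<in> space M" for w
    using measurable_space[OF Y that] by simp
  have ev: "{w \<in> space M. R (Y w)} \<in> events" for R
  proof -
    have "{w \<in> space M. R (Y w)} = Y -` {x \<in> A. R x} \<inter> space M"
      using YA by auto
    then show ?thesis using measurable_sets[OF Y, of "{x \<in> A. R x}"] by simp
  qed
  have "\<P>(w in M. Q (Y w)) = (\<Sum>y\<in>{y\<in>A. Q y}. \<P>(w in M. Y w = y))"
    by (rule prob_sum) (use A ev[of Q] ev[of "\<lambda>y. y = _"] YA in \<open>auto intro!: AE_I2\<close>)
  then show ?thesis
    using A by (simp add: mean_def sum.inter_filter if_distrib cong: if_cong)
qed

lemma mean_const:
  assumes "prob_space M" "Y \<in> measurable M (count_space A)" "finite A"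
  shows "mean M A Y (\<lambda>_. c) = c"
  using mean_indicator[OF assms, of "\<lambda>_. True"] prob_space.prob_space[OF assms(1)]
  by (simp add: mean_def sum_distrib_right[symmetric])

text \<open>Vandermonde's identity sums the Narayana products over \<open>k\<close> to
  \<open>(2 * n + 2) choose n\<close>; absorption then moves the lower index to the centre.\<close>

lemma card_complete_configs:
  "(real n + 2) * real (card (complete_configs n)) = real ((2 * n + 2) choose (n + 1))"
proof -
  have "complete_configs n = (\<Union>k\<in>{..n}. complete_configs_with k (n - k))"
  proof (rule set_eqI)
    fix \<omega> :: complete_config
    show "\<omega> \<in> complete_configs n \<longleftrightarrow> \<omega> \<in> (\<Union>k\<in>{..n}. complete_configs_with k (n - k))"
      using count_Black_White[of "top_row \<omega>"]
      by (cases \<omega>) (auto simp: complete_configs_with_def complete_configs_iff)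
  qed
  then have "card (complete_configs n) = (\<Sum>k\<le>n. card (complete_configs_with k (n - k)))"
    by (simp only:) (subst card_UN_disjoint;
        auto simp: complete_configs_with_def finite_complete_configs)
  then have "(real n + 1) * real (card (complete_configs n))
      = (\<Sum>k\<le>n. (real n + 1) * real (card (complete_configs_with k (n - k))))"
    by (simp add: sum_distrib_left)
  also have "\<dots> = (\<Sum>k\<le>n. real ((n + 1) choose k) * real ((n + 1) choose (n - k)))"
  proof (intro sum.cong refl)
    fix k assume "k \<in> {..n}"
    then have k: "k + (n - k) = n" by simp
    show "(real n + 1) * real (card (complete_configs_with k (n - k)))
        = real ((n + 1) choose k) * real ((n + 1) choose (n - k))"
      using card_complete_configs_with[of k "n - k"] unfolding k .
  qed
  also have "\<dots> = real (\<Sum>k\<le>n. ((n + 1) choose k) * ((n + 1) choose (n - k)))"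
    by simp
  also have "\<dots> = real ((2 * n + 2) choose n)"
    using vandermonde[of "n + 1" "n + 1" n] by (simp add: mult_2)
  finally have 1: "(real n + 1) * real (card (complete_configs n)) = real ((2 * n + 2) choose n)" .
  have "Suc n * ((2 * n + 2) choose Suc n) = (2 * n + 2 - n) * ((2 * n + 2) choose n)"
    by (metis binomial_absorption binomial_absorb_comp)
  also have "2 * n + 2 - n = n + 2" by simp
  finally have "real (Suc n * ((2 * n + 2) choose Suc n)) = real ((n + 2) * ((2 * n + 2) choose n))"
    by (simp only:)
  then have "(real n + 1) * real ((2 * n + 2) choose (n + 1)) = (real n + 2) * real ((2 * n + 2) choose n)"
    unfolding of_nat_mult Suc_eq_plus1 by (simp only: of_nat_add of_nat_1 of_nat_numeral)
  then have "(real n + 1) * ((real n + 2) * real (card (complete_configs n)))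
      = (real n + 1) * real ((2 * n + 2) choose (n + 1))"
    using 1 by (simp add: mult.left_commute)
  then show ?thesis
    by (simp add: add_nonneg_eq_0_iff)
qed

section \<open>A synchronizing word\<close>

lemma length_tasep_move [simp]: "length (tasep_move \<tau> i) = length \<tau>"
  by (simp add: tasep_move_def Let_def)

lemma tasep_move_configs: "\<tau> \<in> configs n \<Longrightarrow> tasep_move \<tau> i \<in> configs n"
  by (simp add: configs_def)

text \<open>The walls \<open>k, ..., 1\<close> carry the white particle leftwards to cell 1, and
  wall 0 then replaces it by a black one.\<close>

lemma sweep_White:
  "foldl tasep_move (replicate k Black @ White # v) (rev [0..<Suc k]) = replicate (Suc k) Black @ v"
proof (induction k arbitrary: v)
  case 0
  show ?case by (simp add: tasep_move_def Let_def cell_def)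
next
  case (Suc k)
  have "tasep_move (replicate (Suc k) Black @ White # v) (Suc k) = replicate k Black @ White # Black # v"
    by (simp add: tasep_move_def Let_def cell_def nth_append list_update_append flip: replicate_append_same)
  then show ?case
    using Suc[of "Black # v"] by (simp add: replicate_app_Cons_same)
qed

text \<open>Walls up to \<open>k\<close> act only on a white particle directly to their right, and
  there is none; the right border lies beyond them.\<close>

lemma sweep_Black:
  "set w \<subseteq> {..k} \<Longrightarrow>
   foldl tasep_move (replicate (Suc k) Black @ v) w = replicate (Suc k) Black @ v"
proof (induction w)
  case (Cons i w)
  have "tasep_move (replicate (Suc k) Black @ v) i = replicate (Suc k) Black @ v"
    using Cons.prems by (auto simp: tasep_move_def Let_def cell_def nth_append nth_Cons')
  then show ?case using Cons by simp
qed simp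

text \<open>Sweep \<open>k\<close> lengthens the black prefix from \<open>k\<close> to
  \<open>k + 1\<close> cells whatever cell \<open>k + 1\<close> holds, so the word works for all
  starting rows at once.\<close>

definition sync_word :: "nat \<Rightarrow> nat list" where
  "sync_word n = concat (map (\<lambda>k. rev [0..<Suc k]) [0..<n])"

lemma foldl_sync_word:
  "k \<le> length xs \<Longrightarrow> foldl tasep_move xs (sync_word k) = replicate k Black @ drop k xs"
proof (induction k)
  case (Suc k)
  have "drop k xs = xs ! k # drop (Suc k) xs"
    using Suc.prems by (simp add: Cons_nth_drop_Suc)
  moreover have "foldl tasep_move (replicate k Black @ x # v) (rev [0..<Suc k])
      = replicate (Suc k) Black @ v" for x v
  proof (cases x)
    case Black
    then show ?thesis
      using sweep_Black[of "rev [0..<Suc k]" k v]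
      by (simp add: replicate_app_Cons_same subset_iff del: upt_Suc foldl_Cons)
  qed (simp only: sweep_White)
  ultimately show ?case
    using Suc by (simp add: sync_word_def)
qed (simp add: sync_word_def)

section \<open>Projection and convergence\<close>

lemma mean_comp:
  assumes M: "prob_space M" "Y \<in> measurable M (count_space A)" and fin: "finite A" "finite B"
    and h: "\<And>x. x \<in> A \<Longrightarrow> h x \<in> B"
  shows "mean M B (\<lambda>w. h (Y w)) f = mean M A Y (\<lambda>x. f (h x))"
proof -
  have "mean M B (\<lambda>w. h (Y w)) f
      = (\<Sum>y\<in>B. \<Sum>x\<in>A. \<P>(w in M. Y w = x) * (if h x = y then f y else 0))"
    unfolding mean_def[of M B]
    by (intro sum.cong refl, subst mean_indicator[OF M fin(1)])
      (auto simp: mean_def sum_distrib_right intro!: sum.cong)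
  also have "\<dots> = (\<Sum>x\<in>A. \<Sum>y\<in>B. \<P>(w in M. Y w = x) * (if h x = y then f y else 0))"
    by (rule sum.swap)
  also have "\<dots> = mean M A Y (\<lambda>x. f (h x))"
    unfolding mean_def using fin h
    by (intro sum.cong refl) (simp flip: sum_distrib_left)
  finally show ?thesis .
qed

text \<open>Lumpability: by \<open>top_T\<close> the two moves agree wall by wall, so a function of
  the top row remains one under averaging.\<close>

lemma funpow_avg_step_top:
  assumes "1 \<le> n"
  shows "\<omega> \<in> complete_configs n \<Longrightarrow>
    (avg_step T n ^^ t) (\<lambda>\<omega>. f (top_row \<omega>)) \<omega> = (avg_step tasep_move n ^^ t) f (top_row \<omega>)"
proof (induction t arbitrary: \<omega>)
  case (Suc t)
  have "(\<Sum>i\<le>n. (avg_step T n ^^ t) (\<lambda>\<omega>. f (top_row \<omega>)) (T \<omega> i))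
      = (\<Sum>i\<le>n. (avg_step tasep_move n ^^ t) f (tasep_move (top_row \<omega>) i))"
    using Suc assms by (intro sum.cong refl) (simp add: T_complete flip: top_T)
  then show ?case
    by (simp add: avg_step_def[of _ _ "(avg_step T n ^^ t) _"]
        avg_step_def[of _ _ "(avg_step tasep_move n ^^ t) _"])
qed simp

text \<open>Stationarity of the uniform distribution in dual form.\<close>

lemma sum_funpow_avg_step_T:
  assumes "1 \<le> n"
  shows "(\<Sum>\<omega>\<in>complete_configs n. (avg_step T n ^^ t) g \<omega>) = (\<Sum>\<omega>\<in>complete_configs n. g \<omega>)"
proof (induction t)
  case (Suc t)
  have "(\<Sum>\<omega>\<in>complete_configs n. (avg_step T n ^^ Suc t) g \<omega>)
      = (\<Sum>\<omega>\<in>complete_configs n. \<Sum>i\<le>n. (avg_step T n ^^ t) g (T \<omega> i)) / (real n + 1)"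
    by (simp add: avg_step_def sum_divide_distrib)
  also have "\<dots> = (\<Sum>\<omega>\<in>complete_configs n. (avg_step T n ^^ t) g \<omega>)"
    unfolding sum_T[OF assms] by (simp add: add_nonneg_eq_0_iff)
  finally show ?case using Suc by simp
qed simp

lemma card_complete_configs_pos: "0 < card (complete_configs n)"
proof -
  have "0 < (2 * n + 2) choose (n + 1)" by (simp add: zero_less_binomial)
  then have "0 < (real n + 2) * real (card (complete_configs n))"
    unfolding card_complete_configs by (simp only: of_nat_0_less_iff)
  then show ?thesis by (simp add: zero_less_mult_iff)
qed

text \<open>For large \<open>t\<close> the averaged function is nearly constant, and its mean over
  top rows of complete configurations is always \<open>\<mu>\<close>. Hence it is uniformly close to
  \<open>\<mu>\<close>, and the initial law does not matter.\<close>

lemma mean_tasep_tendsto: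
  assumes n: "1 \<le> n" and S: "is_TASEP 1 1 1 n M S"
  shows "(\<lambda>t. mean M (configs n) (S t) f) \<longlonglongrightarrow>
    (\<Sum>\<omega>\<in>complete_configs n. f (top_row \<omega>)) / real (card (complete_configs n))"
proof (rule LIMSEQ_I)
  let ?A = "configs n" and ?\<Omega> = "complete_configs n"
  let ?P = "avg_step tasep_move n"
  define \<mu> where "\<mu> = (\<Sum>\<omega>\<in>?\<Omega>. f (top_row \<omega>)) / real (card ?\<Omega>)"
  have chain: "markov_chain M ?A (wall_kernel tasep_move 1 1 1 n) S"
    using S by (simp add: is_TASEP_def)
  then have M: "prob_space M" and meas: "S 0 \<in> measurable M (count_space ?A)"
    by (auto simp: markov_chain_def)
  fix r :: real assume r: "0 < r"
  have osc: "\<bar>f x - f y\<bar> \<le> 2 * (\<Sum>z\<in>?A. \<bar>f z\<bar>)" if "x \<in> ?A" "y \<in> ?A" for x y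
    using member_le_sum[of x ?A "\<lambda>z. \<bar>f z\<bar>"] member_le_sum[of y ?A "\<lambda>z. \<bar>f z\<bar>"] that
    by (simp add: finite_configs)
  have w: "set (sync_word n) \<subseteq> {..n}" "\<And>x. x \<in> ?A \<Longrightarrow> foldl tasep_move x (sync_word n) = replicate n Black"
    using foldl_sync_word[of n] by (auto simp: sync_word_def configs_def)
  have "\<forall>\<^sub>F t in sequentially. \<forall>x\<in>?A. \<forall>y\<in>?A. \<bar>(?P ^^ t) f x - (?P ^^ t) f y\<bar> \<le> r / 2"
    using r by (intro funpow_avg_step_osc_tendsto_0[OF _ w osc]) (auto simp: tasep_move_configs)
  then obtain N where N: "\<And>t x y. N \<le> t \<Longrightarrow> x \<in> ?A \<Longrightarrow> y \<in> ?A \<Longrightarrow> \<bar>(?P ^^ t) f x - (?P ^^ t) f y\<bar> \<le> r / 2"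
    by (auto simp: eventually_sequentially)
  have "\<bar>mean M ?A (S t) f - \<mu>\<bar> < r" if t: "N \<le> t" for t
  proof -
    let ?g = "(?P ^^ t) f"
    have "(\<Sum>\<omega>\<in>?\<Omega>. ?g (top_row \<omega>)) = (\<Sum>\<omega>\<in>?\<Omega>. (avg_step T n ^^ t) (\<lambda>\<omega>. f (top_row \<omega>)) \<omega>)"
      by (intro sum.cong refl) (simp add: funpow_avg_step_top[OF n])
    then have \<mu>: "(\<Sum>\<omega>\<in>?\<Omega>. ?g (top_row \<omega>)) = real (card ?\<Omega>) * \<mu>"
      using card_complete_configs_pos[of n] by (simp add: sum_funpow_avg_step_T[OF n] \<mu>_def)
    have near: "\<bar>?g y - \<mu>\<bar> \<le> r / 2" if y: "y \<in> ?A" for y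
    proof -
      \<comment> \<open>As \<open>\<mu>\<close> is a mean of values of \<open>?g\<close>, its
        distance from \<open>?g y\<close> is at most the oscillation.\<close>
      have "real (card ?\<Omega>) * \<bar>?g y - \<mu>\<bar> = \<bar>\<Sum>\<omega>\<in>?\<Omega>. ?g y - ?g (top_row \<omega>)\<bar>"
        unfolding sum_subtractf \<mu> by (simp flip: right_diff_distrib add: abs_mult)
      also have "\<dots> \<le> (\<Sum>\<omega>\<in>?\<Omega>. \<bar>?g y - ?g (top_row \<omega>)\<bar>)" by (rule sum_abs)
      also have "\<dots> \<le> (\<Sum>\<omega>\<in>?\<Omega>. r / 2)"
        using N[OF t y] by (intro sum_mono) (auto simp: configs_def complete_configs_def)
      finally show ?thesis
        using card_complete_configs_pos[of n] by simp
    qed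
    have "mean M ?A (S t) f - \<mu> = mean M ?A (S 0) ?g - mean M ?A (S 0) (\<lambda>_. \<mu>)"
      using mean_funpow[OF chain finite_configs tasep_move_configs] mean_const[OF M meas finite_configs]
      by simp
    also have "\<dots> = (\<Sum>y\<in>?A. \<P>(w in M. S 0 w = y) * (?g y - \<mu>))"
      by (simp add: mean_def right_diff_distrib sum_subtractf)
    finally have "\<bar>mean M ?A (S t) f - \<mu>\<bar> \<le> (\<Sum>y\<in>?A. \<bar>\<P>(w in M. S 0 w = y) * (?g y - \<mu>)\<bar>)"
      by (simp only: sum_abs)
    also have "\<dots> \<le> mean M ?A (S 0) (\<lambda>_. r / 2)"
      unfolding mean_def abs_mult using near by (intro sum_mono mult_mono) auto
    also have "\<dots> < r"
      using mean_const[OF M meas finite_configs] r by simp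
    finally show ?thesis .
  qed
  then show "\<exists>N. \<forall>t\<ge>N. norm (mean M ?A (S t) f - (\<Sum>\<omega>\<in>?\<Omega>. f (top_row \<omega>)) / real (card ?\<Omega>)) < r"
    unfolding \<mu>_def by auto
qed

text \<open>All \<open>t\<close> steps are moved onto \<open>f\<close>, the initial laws are
  exchanged, and the steps are moved back onto the complete chain by lumpability.\<close>

lemma mean_tasep_eq_mean_top:
  assumes n: "1 \<le> n" and S: "is_TASEP 1 1 1 n M S" and X: "is_complete_chain 1 1 1 n M' X"
    and init: "distr M (count_space (configs n)) (S 0)
         = distr M' (count_space (configs n)) (\<lambda>w. top_row (X 0 w))"
  shows "mean M (configs n) (S t) f = mean M' (complete_configs n) (X t) (\<lambda>\<omega>. f (top_row \<omega>))"
proof -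
  let ?A = "configs n" and ?\<Omega> = "complete_configs n"
  let ?g = "(avg_step tasep_move n ^^ t) f"
  have chain: "markov_chain M ?A (wall_kernel tasep_move 1 1 1 n) S"
    "markov_chain M' ?\<Omega> (wall_kernel T 1 1 1 n) X"
    using S X by (simp_all add: is_TASEP_def is_complete_chain_def)
  then have M': "prob_space M'" and meas: "S 0 \<in> measurable M (count_space ?A)"
    "X 0 \<in> measurable M' (count_space ?\<Omega>)"
    by (auto simp: markov_chain_def)
  have top: "top_row \<omega> \<in> ?A" if "\<omega> \<in> ?\<Omega>" for \<omega>
    using that by (auto simp: complete_configs_def configs_def)
  have meas': "(\<lambda>w. top_row (X 0 w)) \<in> measurable M' (count_space ?A)"
    by (rule measurable_compose[OF meas(2)]) (use top in auto)
  have law: "\<P>(w in M. S 0 w = y) = \<P>(w in M'. top_row (X 0 w) = y)" if y: "y \<in> ?A" for y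
  proof -
    have "measure (distr M (count_space ?A) (S 0)) {y} = \<P>(w in M. S 0 w = y)"
      using y by (subst measure_distr[OF meas(1)]) (auto intro!: arg_cong[where f = "measure M"])
    moreover have "measure (distr M' (count_space ?A) (\<lambda>w. top_row (X 0 w))) {y}
        = \<P>(w in M'. top_row (X 0 w) = y)"
      using y by (subst measure_distr[OF meas']) (auto intro!: arg_cong[where f = "measure M'"])
    ultimately show ?thesis using init by simp
  qed
  have "mean M ?A (S t) f = mean M ?A (S 0) ?g"
    by (rule mean_funpow[OF chain(1) finite_configs tasep_move_configs])
  also have "\<dots> = mean M' ?A (\<lambda>w. top_row (X 0 w)) ?g"
    using law by (simp add: mean_def)
  also have "\<dots> = mean M' ?\<Omega> (X 0) (\<lambda>\<omega>. ?g (top_row \<omega>))"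
    by (rule mean_comp[OF M' meas(2) finite_complete_configs finite_configs top])
  also have "\<dots> = mean M' ?\<Omega> (X 0) ((avg_step T n ^^ t) (\<lambda>\<omega>. f (top_row \<omega>)))"
    by (simp add: mean_def funpow_avg_step_top[OF n])
  also have "\<dots> = mean M' ?\<Omega> (X t) (\<lambda>\<omega>. f (top_row \<omega>))"
    by (rule mean_funpow[OF chain(2) finite_complete_configs T_complete[OF _ n], symmetric])
  finally show ?thesis .
qed

theorem theorem3:
  fixes n :: nat
    and M :: "'a measure" and S :: "nat \<Rightarrow> 'a \<Rightarrow> config"
    and M' :: "'b measure" and X :: "nat \<Rightarrow> 'b \<Rightarrow> complete_config"
  assumes "n \<ge> 1"
    and "is_TASEP 1 1 1 n M S"
    and "is_complete_chain 1 1 1 n M' X"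
    and "distr M (count_space (configs n)) (S 0)
         = distr M' (count_space (configs n)) (\<lambda>w. top_row (X 0 w))"
  shows "(\<forall>\<tau> \<in> configs n.
            (\<forall>t. \<P>(w in M. S t w = \<tau>) = \<P>(w in M'. top_row (X t w) = \<tau>)) \<and>
            (\<lambda>t. \<P>(w in M. S t w = \<tau>)) \<longlonglongrightarrow>
              real (card {\<omega> \<in> complete_configs n. top_row \<omega> = \<tau>}) / real (card (complete_configs n)))
       \<and> (\<forall>k m. k + m = n \<longrightarrow>
            (\<lambda>t. \<P>(w in M. count_list (S t w) Black = k \<and> count_list (S t w) White = m)) \<longlonglongrightarrow>
              real (card (complete_configs_with k m)) / real (card (complete_configs n)) \<and>
            real (card (complete_configs_with k m)) / real (card (complete_configs n))
            = (1 / (real n + 1) * real ((n + 1) choose k) * real ((n + 1) choose m))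
              / (1 / (real n + 2) * real ((2 * n + 2) choose (n + 1))))"
proof -
  have M: "prob_space M" "S t \<in> measurable M (count_space (configs n))"
    and M': "prob_space M'" "X t \<in> measurable M' (count_space (complete_configs n))" for t
    using assms(2,3) by (auto simp: is_TASEP_def is_complete_chain_def markov_chain_def)
  note S_mean = mean_indicator[OF M finite_configs]
  note X_mean = mean_indicator[OF M' finite_complete_configs]
  have law: "\<P>(w in M. S t w = \<tau>) = \<P>(w in M'. top_row (X t w) = \<tau>)" for t \<tau>
    using S_mean[of "\<lambda>x. x = \<tau>" t] X_mean[of "\<lambda>\<omega>. top_row \<omega> = \<tau>" t]
      mean_tasep_eq_mean_top[OF assms, of t "\<lambda>x. if x = \<tau> then 1 else 0"] by simp
  \<comment> \<open>A general property \<open>Q\<close> covers both the single configurations and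
    the particle counts.\<close>
  have lim: "(\<lambda>t. \<P>(w in M. Q (S t w))) \<longlonglongrightarrow>
      real (card {\<omega> \<in> complete_configs n. Q (top_row \<omega>)}) / real (card (complete_configs n))" for Q
  proof -
    have "(\<Sum>\<omega>\<in>complete_configs n. if Q (top_row \<omega>) then 1 else 0 :: real)
        = real (card {\<omega> \<in> complete_configs n. Q (top_row \<omega>)})"
      by (simp add: finite_complete_configs flip: sum.inter_filter)
    then show ?thesis
      using mean_tasep_tendsto[OF assms(1,2), of "\<lambda>x. if Q x then 1 else 0"]
      by (simp add: S_mean)
  qed
  have ratio: "real (card (complete_configs_with k m)) / real (card (complete_configs n))
      = (1 / (real n + 1) * real ((n + 1) choose k) * real ((n + 1) choose m))
        / (1 / (real n + 2) * real ((2 * n + 2) choose (n + 1)))" if "k + m = n" for k m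
  proof -
    have nz: "real n + 1 \<noteq> 0" "real n + 2 \<noteq> 0" by linarith+
    have "real (card (complete_configs_with k m)) = 1 / (real n + 1) * real ((n + 1) choose k) * real ((n + 1) choose m)"
      using card_complete_configs_with[of k m] nz unfolding that by (simp add: field_simps)
    moreover have "real (card (complete_configs n)) = 1 / (real n + 2) * real ((2 * n + 2) choose (n + 1))"
      using card_complete_configs[of n] nz by (simp add: field_simps)
    ultimately show ?thesis by simp
  qed
  have "complete_configs_with k m
      = {\<omega> \<in> complete_configs n. count_list (top_row \<omega>) Black = k \<and> count_list (top_row \<omega>) White = m}"
    if "k + m = n" for k m
    using that by (simp add: complete_configs_with_def)
  then have lim_km: "(\<lambda>t. \<P>(w in M. count_list (S t w) Black = k \<and> count_list (S t w) White = m)) \<longlonglongrightarrow>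
      real (card (complete_configs_with k m)) / real (card (complete_configs n))" if "k + m = n" for k m
    using lim[of "\<lambda>x. count_list x Black = k \<and> count_list x White = m"] that by simp
  show ?thesis
    by (intro conjI ballI allI impI law lim[of "\<lambda>x. x = _"] lim_km ratio)
qed

end
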